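(* Assume periodic boundaries, or impermeable walls on which $\mathbf u\cdot\mathbf n=0$ and $\mathbf B\cdot\mathbf n=0$ hold at every boundary face. Consider one time step of the scheme described in the context, prior to any divergence-free correction of the magnetic field, so that the magnetic field is the predictor $\tilde{\mathbf B}^{n+1}$. Let the total energy at the new time level be defined cell-wise by $$E^{n+1}_{ij}=\underline{\mathbf V}_{\mathrm{mod}}\big(p^{n+1}_{ij}\big)+\frac{\big|(\rho\mathbf u)^{n+1}_{ij}\big|^2}{2\rho^{n+1}_{ij}}+\tfrac12\big\|\tilde{\mathbf B}^{n+1}_{ij}\big\|^2,$$ where $p^{n+1}$ is the exact (converged) solution of the discrete pressure system $\underline{\mathbf V}_{\mathrm{mod}}(\mathbf p)+\mathbf T\mathbf p=\mathbf b$ with $\mathbf b$ as in the context. Then the total discrete energy is globally conserved: $$\sum_{ij}E^{n+1}_{ij}\,\Delta x\,\Delta y=\sum_{ij}E^{n}_{ij}\,\Delta x\,\Delta y .$$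
   Context: Setting: a uniform Cartesian grid of $N=n_xn_y$ cells $(i,j)$, spacings $\Delta x,\Delta y$, time step $\Delta t$; cell-centred unknowns are density $\rho>0$, momentum $\rho\mathbf u=(\rho u,\rho v,\rho w)$, total energy $E$, magnetic field $\mathbf B=(B_x,B_y,B_z)$, pressure $p$. For each flux, $\mathcal F^x,\mathcal F^y$ denote conservative flux-divergence operators: $\mathcal F^x(f)_{ij}=(f_{i+\frac12,j}-f_{i-\frac12,j})/\Delta x$, $\mathcal F^y(g)_{ij}=(g_{i,j+\frac12}-g_{i,j-\frac12})/\Delta y$, with interface values that are single-valued (the two cells sharing a face use the same numerical flux). On impermeable walls, every numerical energy flux at a boundary face is evaluated with $\mathbf u\cdot\mathbf n=0$ and $\mathbf B\cdot\mathbf n=0$ (so fluxes proportional to these quantities vanish there), for all velocities, momenta and magnetic fields that appear in the step. One time step $t^n\to t^{n+1}$: (1) Advective step: $\rho^{n+1}$, $(\rho\mathbf u)^\star$ from conservative explicit updates, and $E^\star_{ij}=E^n_{ij}-\Delta t[\mathcal F^x(ku)+\mathcal F^y(kv)]^n_{ij}$ with $k=\tfrac12\rho|\mathbf u|^2$ and Rusanov interface fluxes: the average of the left and right fluxes minus $\tfrac12 s^{\max}$ times the jump of $E$, where $s^{\max}$ is the maximum of the absolute values of the face-normal velocities on the two sides. (2) A predictor magnetic field $\tilde{\mathbf B}^{n+1}$ is computed from an implicit magnetic system. (3) Magnetic step: $(\rho\mathbf u)^{**}$ from a conservative update with the magnetic momentum fluxes, and $E^{**}_{ij}=E^\star_{ij}-\Delta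 t\big[\mathcal F^x(\|\mathbf B\|^2u-B_x(\mathbf u\cdot\mathbf B))+\mathcal F^y(\|\mathbf B\|^2v-B_y(\mathbf u\cdot\mathbf B))\big]_{ij}$, evaluated with $\mathbf B=\tilde{\mathbf B}^{n+1}$ and velocity $(\rho\mathbf u)^\star/\rho^{n+1}$. (4) A first pressure solve gives $\tilde p^{n+1}$ (the system in (6) with $(\rho\mathbf u)^{**}$ in place of $(\rho\mathbf u)^{n+1}$). (5) Momentum update $(\rho\mathbf u)^{n+1}=(\rho\mathbf u)^{**}-\Delta t\,\nabla\tilde p^{n+1}$ (discrete gradient). (6) Second pressure solve: $p^{n+1}$ solves $\underline{\mathbf V}_{\mathrm{mod}}(\mathbf p)+\mathbf T\mathbf p=\mathbf b$ with $$b_{ij}=E^{**}_{ij}-\tfrac12\|\tilde{\mathbf B}^{n+1}_{ij}\|^2-\frac{|(\rho\mathbf u)^{n+1}_{ij}|^2}{2\rho^{n+1}_{ij}}-\Delta t\big[\mathcal F^x(h^n(\rho u)^{**})+\mathcal F^y(h^n(\rho v)^{**})\big]_{ij},$$ where $h^n$ is the specific enthalpy. Matrix $\mathbf T$. $\mathbf T\mathbf q=-\Delta t^2\mathbb L(h^n,\mathbf q)-\Delta t\,\mathbb L(\tilde\kappa^n,\mathbf q)$, where $$\mathbb L(\kappa,q)_{ij}=\tfrac1{\Delta x^2}\big(\kappa_{i+\frac12,j}(q_{i+1,j}-q_{ij})-\kappa_{i-\frac12,j}(q_{ij}-q_{i-1,j})\big)+\tfrac1{\Delta y^2}\big(\kappa_{i,j+\frac12}(q_{i,j+1}-q_{ij})-\kappa_{i,j-\frac12}(q_{ij}-q_{i,j-1})\big),$$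 with face coefficients the arithmetic averages of adjacent cell values of $h^n$, and of $\tilde\kappa^{x,n}$ (on $x$-faces) or $\tilde\kappa^{y,n}$ (on $y$-faces); $h^n_f>0$, $\tilde\kappa^n_f\ge0$ at all faces. Indices wrap around for periodic boundaries; for walls the terms of boundary faces are zero. Modified internal energy. With floor $p_\varepsilon>0$ and slope $M>0$, and with $V(p)=\rho e(\rho,p)$ the equation-of-state internal energy density evaluated cell-wise at $\rho=\rho^{n+1}_{ij}$ (strictly increasing in $p$), $V_{\mathrm{mod}}(p)=V(p)$ for $p\ge p_\varepsilon$ and $V_{\mathrm{mod}}(p)=V(p_\varepsilon)+M(p-p_\varepsilon)$ for $p<p_\varepsilon$; $\underline{\mathbf V}_{\mathrm{mod}}$ acts cell-wise. *)

theory Defs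
  imports "HOL-Analysis.Analysis"
begin

section \<open>Grid\<close>

datatype bc = Periodic | Wall

datatype dir = X | Y

text \<open>Each coordinate direction is either periodic or bounded by two impermeable walls.\<close>

record grid =
  nx :: nat
  ny :: nat
  dx :: real
  dy :: real
  bcx :: bc
  bcy :: bc

text \<open>
  Cells are indexed by \<open>(i, j)\<close> with \<open>i < nx\<close> and \<open>j < ny\<close>. The face of direction \<open>X\<close> with
  index \<open>(i, j)\<close> is the lower face \<open>(i - 1/2, j)\<close> of cell \<open>(i, j)\<close>, and the face of direction \<open>Y\<close>
  with that index is \<open>(i, j - 1/2)\<close>. In a periodic direction with \<open>n\<close> cells there are \<open>n\<close> faces
  (the last face of the last cell is face 0); in a direction with walls there are \<open>n + 1\<close>,
  and faces \<open>0\<close> and \<open>n\<close> are the walls. A function of the face index therefore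
  gives both cells sharing a face the same value.
\<close>

type_synonym 'a cellfun = "nat \<times> nat \<Rightarrow> 'a"
type_synonym 'a facefun = "nat \<times> nat \<Rightarrow> 'a"

definition valid_grid :: "grid \<Rightarrow> bool" where
  "valid_grid G \<longleftrightarrow> nx G > 0 \<and> ny G > 0 \<and> dx G > 0 \<and> dy G > 0"

definition cells :: "grid \<Rightarrow> (nat \<times> nat) set" where
  "cells G = {..<nx G} \<times> {..<ny G}"

fun spacing :: "grid \<Rightarrow> dir \<Rightarrow> real" where
  "spacing G X = dx G"
| "spacing G Y = dy G"

fun faces :: "grid \<Rightarrow> dir \<Rightarrow> (nat \<times> nat) set" where
  "faces G X = (case bcx G of Periodic \<Rightarrow> {..<nx G} | Wall \<Rightarrow> {..nx G}) \<times> {..<ny G}"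
| "faces G Y = {..<nx G} \<times> (case bcy G of Periodic \<Rightarrow> {..<ny G} | Wall \<Rightarrow> {..ny G})"

fun is_wall :: "grid \<Rightarrow> dir \<Rightarrow> nat \<times> nat \<Rightarrow> bool" where
  "is_wall G X (i, j) \<longleftrightarrow> bcx G = Wall \<and> (i = 0 \<or> i = nx G)"
| "is_wall G Y (i, j) \<longleftrightarrow> bcy G = Wall \<and> (j = 0 \<or> j = ny G)"

definition wall_faces :: "grid \<Rightarrow> dir \<Rightarrow> (nat \<times> nat) set" where
  "wall_faces G d = {f \<in> faces G d. is_wall G d f}"

definition inner_faces :: "grid \<Rightarrow> dir \<Rightarrow> (nat \<times> nat) set" where
  "inner_faces G d = {f \<in> faces G d. \<not> is_wall G d f}"

text \<open>
  The upper face of a cell (its lower face has the index of the cell itself), and the two cells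
  adjacent to a face that is not a wall.
\<close>

fun upper_face :: "grid \<Rightarrow> dir \<Rightarrow> nat \<times> nat \<Rightarrow> nat \<times> nat" where
  "upper_face G X (i, j) = (case bcx G of Periodic \<Rightarrow> Suc i mod nx G | Wall \<Rightarrow> Suc i, j)"
| "upper_face G Y (i, j) = (i, case bcy G of Periodic \<Rightarrow> Suc j mod ny G | Wall \<Rightarrow> Suc j)"

fun lcell :: "grid \<Rightarrow> dir \<Rightarrow> nat \<times> nat \<Rightarrow> nat \<times> nat" where
  "lcell G X (i, j) = (if i = 0 then nx G - 1 else i - 1, j)"
| "lcell G Y (i, j) = (i, if j = 0 then ny G - 1 else j - 1)"

definition rcell :: "grid \<Rightarrow> dir \<Rightarrow> nat \<times> nat \<Rightarrow> nat \<times> nat" where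
  "rcell G d f = f"

fun normal_ix :: "dir \<Rightarrow> 3" where
  "normal_ix X = 1"
| "normal_ix Y = 2"

section \<open>Discrete operators\<close>

definition flux_diff :: "grid \<Rightarrow> dir \<Rightarrow> 'a::real_vector facefun \<Rightarrow> 'a cellfun" where
  "flux_diff G d F c = (F (upper_face G d c) - F c) /\<^sub>R spacing G d"

definition flux_div :: "grid \<Rightarrow> (dir \<Rightarrow> 'a::real_vector facefun) \<Rightarrow> 'a cellfun" where
  "flux_div G F c = flux_diff G X (F X) c + flux_diff G Y (F Y) c"

definition face_avg :: "grid \<Rightarrow> dir \<Rightarrow> real cellfun \<Rightarrow> real facefun" where
  "face_avg G d k f = (k (lcell G d f) + k (rcell G d f)) / 2"

definition face_grad_term :: "grid \<Rightarrow> dir \<Rightarrow> real cellfun \<Rightarrow> real cellfun \<Rightarrow> real facefun" where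
  "face_grad_term G d k q f =
     (if is_wall G d f then 0 else face_avg G d k f * (q (rcell G d f) - q (lcell G d f)))"

text \<open>The coefficient may have different cell values for the two directions.\<close>

definition lap :: "grid \<Rightarrow> (dir \<Rightarrow> real cellfun) \<Rightarrow> real cellfun \<Rightarrow> real cellfun" where
  "lap G k q c =
     (face_grad_term G X (k X) q (upper_face G X c) - face_grad_term G X (k X) q c) / (dx G)\<^sup>2
   + (face_grad_term G Y (k Y) q (upper_face G Y c) - face_grad_term G Y (k Y) q c) / (dy G)\<^sup>2"

definition T_op :: "grid \<Rightarrow> real \<Rightarrow> real cellfun \<Rightarrow> (dir \<Rightarrow> real cellfun) \<Rightarrow> real cellfun \<Rightarrow> real cellfun"
  where "T_op G dt h kap q c = - dt\<^sup>2 * lap G (\<lambda>_. h) q c - dt * lap G kap q c"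

text \<open>
  The discrete pressure gradient is not fixed: any operator that vanishes on constant pressures
  and, the grid being two-dimensional, has no third component.
\<close>

definition discrete_gradient :: "grid \<Rightarrow> (real cellfun \<Rightarrow> (real^3) cellfun) \<Rightarrow> bool" where
  "discrete_gradient G grad \<longleftrightarrow>
     (\<forall>c\<in>cells G. (\<forall>a. grad (\<lambda>_. a) c = 0) \<and> (\<forall>q. grad q c $ 3 = 0))"

section \<open>Interface fluxes\<close>

definition mass_flux :: "dir \<Rightarrow> real \<times> (real^3) \<Rightarrow> real" where
  "mass_flux d = (\<lambda>(\<rho>, u). \<rho> * u $ normal_ix d)"

definition momentum_flux :: "dir \<Rightarrow> real \<times> (real^3) \<Rightarrow> real^3" where
  "momentum_flux d = (\<lambda>(\<rho>, u). (\<rho> * u $ normal_ix d) *\<^sub>R u)"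

definition mag_momentum_flux :: "dir \<Rightarrow> (real^3) \<times> (real^3) \<Rightarrow> real^3" where
  "mag_momentum_flux d =
     (\<lambda>(B, u). ((norm B)\<^sup>2 / 2) *\<^sub>R axis (normal_ix d) 1 - (B $ normal_ix d) *\<^sub>R B)"

definition mag_energy_flux :: "dir \<Rightarrow> (real^3) \<times> (real^3) \<Rightarrow> real" where
  "mag_energy_flux d =
     (\<lambda>(B, u). (norm B)\<^sup>2 * u $ normal_ix d - B $ normal_ix d * (u \<bullet> B))"

definition enthalpy_flux :: "dir \<Rightarrow> real \<times> (real^3) \<Rightarrow> real" where
  "enthalpy_flux d = (\<lambda>(h, m). h * m $ normal_ix d)"

text \<open>
  A numerical flux maps the cell states to one value per face. Its stencil and formula are left
  open; it only has to reproduce the physical flux on constant states, away from walls.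
\<close>

definition consistent_flux ::
  "grid \<Rightarrow> (dir \<Rightarrow> 's \<Rightarrow> 'a) \<Rightarrow> (dir \<Rightarrow> 's cellfun \<Rightarrow> 'a facefun) \<Rightarrow> bool" where
  "consistent_flux G phys N \<longleftrightarrow> (\<forall>d. \<forall>f\<in>inner_faces G d. \<forall>s. N d (\<lambda>_. s) f = phys d s)"

text \<open>On a wall, the physical flux is evaluated at a boundary state prescribed there.\<close>

definition with_wall_state ::
  "grid \<Rightarrow> (dir \<Rightarrow> 's \<Rightarrow> 'a) \<Rightarrow> (dir \<Rightarrow> 's cellfun \<Rightarrow> 'a facefun) \<Rightarrow> (dir \<Rightarrow> 's facefun) \<Rightarrow>
   's cellfun \<Rightarrow> dir \<Rightarrow> 'a facefun" where
  "with_wall_state G phys N w q d f = (if is_wall G d f then phys d (w d f) else N d q f)"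

record adv_state =
  dens :: real
  vel :: "real^3"
  energy :: real

definition kin_energy_flux :: "dir \<Rightarrow> adv_state \<Rightarrow> real" where
  "kin_energy_flux d s = (dens s * (norm (vel s))\<^sup>2 / 2) * vel s $ normal_ix d"

definition rusanov :: "dir \<Rightarrow> adv_state \<Rightarrow> adv_state \<Rightarrow> real" where
  "rusanov d l r =
     (kin_energy_flux d l + kin_energy_flux d r) / 2
     - max \<bar>vel l $ normal_ix d\<bar> \<bar>vel r $ normal_ix d\<bar> / 2 * (energy r - energy l)"

text \<open>On a wall, \<open>wl\<close> and \<open>wr\<close> are the states on the lower and upper side of the face.\<close>

definition adv_energy_flux ::
  "grid \<Rightarrow> (dir \<Rightarrow> adv_state facefun) \<Rightarrow> (dir \<Rightarrow> adv_state facefun) \<Rightarrow>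
   adv_state cellfun \<Rightarrow> dir \<Rightarrow> real facefun" where
  "adv_energy_flux G wl wr q d f =
     (if is_wall G d f then rusanov d (wl d f) (wr d f)
      else rusanov d (q (lcell G d f)) (q (rcell G d f)))"

section \<open>Pressure system\<close>

text \<open>
  The equation of state is given by \<open>rhoe \<rho> p\<close>, the internal energy density \<open>\<rho> e(\<rho>, p)\<close>.
\<close>

definition enthalpy :: "(real \<Rightarrow> real \<Rightarrow> real) \<Rightarrow> real \<Rightarrow> real \<Rightarrow> real" where
  "enthalpy rhoe \<rho> p = (rhoe \<rho> p + p) / \<rho>"

definition V_mod :: "(real \<Rightarrow> real) \<Rightarrow> real \<Rightarrow> real \<Rightarrow> real \<Rightarrow> real" where
  "V_mod V p\<epsilon> M p = (if p \<ge> p\<epsilon> then V p else V p\<epsilon> + M * (p - p\<epsilon>))"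

text \<open>\<open>m\<close> is the momentum in the kinetic energy, \<open>H\<close> the interface enthalpy flux.\<close>

definition pressure_rhs ::
  "grid \<Rightarrow> real \<Rightarrow> real cellfun \<Rightarrow> (real^3) cellfun \<Rightarrow> real cellfun \<Rightarrow> (real^3) cellfun \<Rightarrow>
   (dir \<Rightarrow> real facefun) \<Rightarrow> real cellfun" where
  "pressure_rhs G dt E B \<rho> m H c =
     E c - (norm (B c))\<^sup>2 / 2 - (norm (m c))\<^sup>2 / (2 * \<rho> c) - dt * flux_div G H c"

definition solves_pressure_system ::
  "grid \<Rightarrow> real \<Rightarrow> (real \<Rightarrow> real \<Rightarrow> real) \<Rightarrow> real \<Rightarrow> real \<Rightarrow> real cellfun \<Rightarrow>
   real cellfun \<Rightarrow> (dir \<Rightarrow> real cellfun) \<Rightarrow> real cellfun \<Rightarrow> real cellfun \<Rightarrow> bool" where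
  "solves_pressure_system G dt rhoe p\<epsilon> M \<rho> h kap b p \<longleftrightarrow>
     (\<forall>c\<in>cells G. V_mod (rhoe (\<rho> c)) p\<epsilon> M (p c) + T_op G dt h kap p c = b c)"

end

theory Submission
  imports Defs
begin

text \<open>
  Adding the definition of the new energy to the pressure equation, the kinetic and magnetic
  energies cancel against those in the right-hand side, and the new energy is the old one plus
  flux differences: three explicit ones (advective, magnetic, enthalpy), and the two Laplacians
  of the pressure, which are differences of face terms as well. All of these
  face values vanish on walls, so each sum over the cells telescopes to zero.
\<close>

text \<open>The cyclic successor permutes the indices: the last one wraps around to
  \<open>0\<close>, which supplies the term missing from the shifted sum.\<close>

lemma sum_shift_mod:
  fixes g :: "nat \<Rightarrow> 'a::comm_monoid_add"
  shows "(\<Sum>i<n. g (Suc i mod n)) = (\<Sum>i<n. g i)"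
proof (cases n)
  case (Suc m)
  have "(\<Sum>i<Suc m. g (Suc i mod Suc m)) = (\<Sum>i<m. g (Suc i)) + g 0"
    by simp
  also have "\<dots> = (\<Sum>i<Suc m. g i)"
    by (subst sum.lessThan_Suc_shift) (simp add: add.commute)
  finally show ?thesis
    using Suc by simp
qed simp

text \<open>Both orders of summation are provided so that the inner sum can run along either grid
  direction.\<close>

lemma sum_cells:
  "(\<Sum>c\<in>cells G. f c) = (\<Sum>i<nx G. \<Sum>j<ny G. f (i, j))"
  "(\<Sum>c\<in>cells G. f c) = (\<Sum>j<ny G. \<Sum>i<nx G. f (i, j))"
proof -
  show 1: "(\<Sum>c\<in>cells G. f c) = (\<Sum>i<nx G. \<Sum>j<ny G. f (i, j))"
    by (simp add: cells_def sum.cartesian_product)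
  show "(\<Sum>c\<in>cells G. f c) = (\<Sum>j<ny G. \<Sum>i<nx G. f (i, j))"
    unfolding 1 by (rule sum.swap)
qed

text \<open>On a periodic line the shifted sum cancels the unshifted one; between walls the sum
  telescopes to \<open>g n - g 0\<close>, both of which are wall values. The case expression is that
  of \<open>upper_face\<close>.\<close>

lemma sum_difference_line:
  fixes g :: "nat \<Rightarrow> 'a::ab_group_add"
  assumes "b = Wall \<Longrightarrow> g 0 = 0" "b = Wall \<Longrightarrow> g n = 0"
  shows "(\<Sum>i<n. g (case b of Periodic \<Rightarrow> Suc i mod n | Wall \<Rightarrow> Suc i) - g i) = 0"
proof (cases b)
  case Periodic
  then show ?thesis
    by (simp add: sum_subtractf sum_shift_mod)
next
  case Wall
  then show ?thesis
    using assms by (simp add: sum_lessThan_telescope)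
qed

lemma sum_flux_diff_eq_0:
  assumes "\<And>f. f \<in> wall_faces G d \<Longrightarrow> F f = 0"
  shows "(\<Sum>c\<in>cells G. flux_diff G d F c) = 0"
proof -
  have "(\<Sum>c\<in>cells G. F (upper_face G d c) - F c) = 0"
  proof (cases d)
    case X
    \<comment> \<open>Each grid row telescopes separately. With walls there is one more face than
      cells, so the faces with first index \<open>0\<close> and \<open>nx G\<close> both lie in
      \<open>wall_faces\<close>.\<close>
    have "(\<Sum>i<nx G. F (upper_face G X (i, j)) - F (i, j)) = 0" if "j < ny G" for j
      using sum_difference_line[of "bcx G" "\<lambda>i. F (i, j)" "nx G"] assms that X
      by (simp add: wall_faces_def)
    then show ?thesis
      unfolding sum_cells(2) X by (intro sum.neutral) simp
  next
    case Y
    have "(\<Sum>j<ny G. F (upper_face G Y (i, j)) - F (i, j)) = 0" if "i < nx G" for i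
      using sum_difference_line[of "bcy G" "\<lambda>j. F (i, j)" "ny G"] assms that Y
      by (simp add: wall_faces_def)
    then show ?thesis
      unfolding sum_cells(1) Y by (intro sum.neutral) simp
  qed
  then show ?thesis
    by (simp add: flux_diff_def flip: scaleR_sum_right)
qed

lemma sum_flux_div_eq_0:
  assumes "\<And>d f. f \<in> wall_faces G d \<Longrightarrow> F d f = 0"
  shows "(\<Sum>c\<in>cells G. flux_div G F c) = 0"
  using assms by (simp add: flux_div_def sum.distrib sum_flux_diff_eq_0)

text \<open>One factor of the squared spacing goes into the face flux, the other is the division in
  \<open>flux_diff\<close>. This puts the pressure terms in conservative form.\<close>

lemma lap_eq_flux_div:
  "lap G k q c = flux_div G (\<lambda>d f. face_grad_term G d (k d) q f / spacing G d) c"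
  by (simp add: lap_def flux_div_def flux_diff_def divide_inverse power2_eq_square
      algebra_simps)

text \<open>The wall condition is built into \<open>face_grad_term\<close>, which is zero there by
  definition.\<close>

lemma sum_lap_eq_0: "(\<Sum>c\<in>cells G. lap G k q c) = 0"
  unfolding lap_eq_flux_div
  by (rule sum_flux_div_eq_0) (simp add: wall_faces_def face_grad_term_def)

lemma sum_T_op_eq_0: "(\<Sum>c\<in>cells G. T_op G dt h kap q c) = 0"
  by (simp add: T_op_def sum_subtractf sum_negf sum_lap_eq_0 flip: sum_distrib_left)

text \<open>The right-hand side subtracts kinetic and magnetic energies with the same
  \<open>m\<close>, \<open>\<rho>\<close> and \<open>B\<close> that are added back here, so they
  cancel cell by cell and only conservative terms remain beside \<open>E\<close>.\<close>

lemma sum_pressure_solution: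
  assumes "solves_pressure_system G dt rhoe p\<epsilon> M \<rho> h kap (pressure_rhs G dt E B \<rho> m H) p"
    and "\<And>d f. f \<in> wall_faces G d \<Longrightarrow> H d f = 0"
  shows "(\<Sum>c\<in>cells G. V_mod (rhoe (\<rho> c)) p\<epsilon> M (p c) + (norm (m c))\<^sup>2 / (2 * \<rho> c)
           + (norm (B c))\<^sup>2 / 2) = (\<Sum>c\<in>cells G. E c)"
proof -
  have "(\<Sum>c\<in>cells G. V_mod (rhoe (\<rho> c)) p\<epsilon> M (p c) + (norm (m c))\<^sup>2 / (2 * \<rho> c)
           + (norm (B c))\<^sup>2 / 2)
      = (\<Sum>c\<in>cells G. E c - dt * flux_div G H c - T_op G dt h kap p c)"
    using assms(1)
    by (intro sum.cong) (auto simp: solves_pressure_system_def pressure_rhs_def algebra_simps)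
  also have "\<dots> = (\<Sum>c\<in>cells G. E c)"
    using assms(2)
    by (simp add: sum_subtractf sum_T_op_eq_0 sum_flux_div_eq_0 flip: sum_distrib_left)
  finally show ?thesis .
qed

lemma sum_explicit_update:
  fixes E E' :: "real cellfun"
  assumes "\<And>c. c \<in> cells G \<Longrightarrow> E' c = E c - dt * flux_div G F c"
    and "\<And>d f. f \<in> wall_faces G d \<Longrightarrow> F d f = 0"
  shows "(\<Sum>c\<in>cells G. E' c) = (\<Sum>c\<in>cells G. E c)"
  using assms by (simp add: sum_subtractf sum_flux_div_eq_0 flip: sum_distrib_left)

text \<open>The normal velocity is a factor of the central part and also of the Rusanov dissipation
  coefficient, so the flux vanishes whatever the energy jump across the wall.\<close>

lemma adv_energy_flux_wall:
  assumes "f \<in> wall_faces G d"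
    and "vel (wl d f) $ normal_ix d = 0" "vel (wr d f) $ normal_ix d = 0"
  shows "adv_energy_flux G wl wr q d f = 0"
  using assms by (simp add: adv_energy_flux_def wall_faces_def rusanov_def kin_energy_flux_def)

lemma mag_energy_flux_wall:
  assumes "f \<in> wall_faces G d"
    and "fst (w d f) $ normal_ix d = 0" "snd (w d f) $ normal_ix d = 0"
  shows "with_wall_state G mag_energy_flux N w q d f = 0"
  using assms
  by (simp add: with_wall_state_def wall_faces_def mag_energy_flux_def case_prod_beta)

lemma enthalpy_flux_wall:
  assumes "f \<in> wall_faces G d" and "snd (w d f) $ normal_ix d = 0"
  shows "with_wall_state G enthalpy_flux N w q d f = 0"
  using assms
  by (simp add: with_wall_state_def wall_faces_def enthalpy_flux_def case_prod_beta)

theorem theorem2: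
  fixes G :: grid and dt p\<epsilon> M :: real
    and rhoe :: "real \<Rightarrow> real \<Rightarrow> real"
    and \<rho>0 \<rho>1 E0 Es Ess E1 p0 pt p1 h :: "real cellfun"
    and m0 ms mss m1 u0 us Bt :: "(real^3) cellfun"
    and kap :: "dir \<Rightarrow> real cellfun"
    and grad :: "real cellfun \<Rightarrow> (real^3) cellfun"
    and Nmass :: "dir \<Rightarrow> (real \<times> (real^3)) cellfun \<Rightarrow> real facefun"
    and Nmom :: "dir \<Rightarrow> (real \<times> (real^3)) cellfun \<Rightarrow> (real^3) facefun"
    and Nmagm :: "dir \<Rightarrow> ((real^3) \<times> (real^3)) cellfun \<Rightarrow> (real^3) facefun"
    and Nmage :: "dir \<Rightarrow> ((real^3) \<times> (real^3)) cellfun \<Rightarrow> real facefun"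
    and Nent :: "dir \<Rightarrow> (real \<times> (real^3)) cellfun \<Rightarrow> real facefun"
    and wl wr :: "dir \<Rightarrow> adv_state facefun"
    and wmag :: "dir \<Rightarrow> ((real^3) \<times> (real^3)) facefun"
    and went :: "dir \<Rightarrow> (real \<times> (real^3)) facefun"
    and H :: "dir \<Rightarrow> real facefun"
  assumes grid: "valid_grid G" and dt: "dt > 0"
    and floor: "p\<epsilon> > 0" "M > 0"
    and eos: "\<And>\<rho>. \<rho> > 0 \<Longrightarrow> strict_mono_on {0<..} (rhoe \<rho>)"
    and density: "\<And>c. c \<in> cells G \<Longrightarrow> \<rho>0 c > 0" "\<And>c. c \<in> cells G \<Longrightarrow> \<rho>1 c > 0"
    \<comment> \<open>coefficients of the pressure system\<close>
    and h_def: "\<And>c. c \<in> cells G \<Longrightarrow> h c = enthalpy rhoe (\<rho>0 c) (p0 c)"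
    and h_pos: "\<And>d f. f \<in> inner_faces G d \<Longrightarrow> face_avg G d h f > 0"
    and kap_nonneg: "\<And>d f. f \<in> inner_faces G d \<Longrightarrow> face_avg G d (kap d) f \<ge> 0"
    \<comment> \<open>numerical fluxes and discrete gradient\<close>
    and consistency:
      "consistent_flux G mass_flux Nmass"
      "consistent_flux G momentum_flux Nmom"
      "consistent_flux G mag_momentum_flux Nmagm"
      "consistent_flux G mag_energy_flux Nmage"
      "consistent_flux G enthalpy_flux Nent"
      "discrete_gradient G grad"
    \<comment> \<open>impermeable walls (void if both directions are periodic)\<close>
    and wall_adv: "\<And>d f. f \<in> wall_faces G d \<Longrightarrow>
        vel (wl d f) $ normal_ix d = 0 \<and> vel (wr d f) $ normal_ix d = 0"
    and wall_mag: "\<And>d f. f \<in> wall_faces G d \<Longrightarrow>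
        fst (wmag d f) $ normal_ix d = 0 \<and> snd (wmag d f) $ normal_ix d = 0"
    and wall_ent: "\<And>d f. f \<in> wall_faces G d \<Longrightarrow> snd (went d f) $ normal_ix d = 0"
    \<comment> \<open>advective step\<close>
    and u0: "\<And>c. c \<in> cells G \<Longrightarrow> u0 c = m0 c /\<^sub>R \<rho>0 c"
    and step_\<rho>: "\<And>c. c \<in> cells G \<Longrightarrow>
        \<rho>1 c = \<rho>0 c - dt * flux_div G (\<lambda>d. Nmass d (\<lambda>c. (\<rho>0 c, u0 c))) c"
    and step_ms: "\<And>c. c \<in> cells G \<Longrightarrow>
        ms c = m0 c - dt *\<^sub>R flux_div G (\<lambda>d. Nmom d (\<lambda>c. (\<rho>0 c, u0 c))) c"
    and step_Es: "\<And>c. c \<in> cells G \<Longrightarrow>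
        Es c = E0 c - dt * flux_div G (adv_energy_flux G wl wr
                 (\<lambda>c. \<lparr>dens = \<rho>0 c, vel = u0 c, energy = E0 c\<rparr>)) c"
    \<comment> \<open>magnetic step, with predictor field \<open>Bt\<close>\<close>
    and us: "\<And>c. c \<in> cells G \<Longrightarrow> us c = ms c /\<^sub>R \<rho>1 c"
    and step_mss: "\<And>c. c \<in> cells G \<Longrightarrow>
        mss c = ms c - dt *\<^sub>R flux_div G (\<lambda>d. Nmagm d (\<lambda>c. (Bt c, us c))) c"
    and step_Ess: "\<And>c. c \<in> cells G \<Longrightarrow>
        Ess c = Es c - dt * flux_div G
                  (with_wall_state G mag_energy_flux Nmage wmag (\<lambda>c. (Bt c, us c))) c"
    \<comment> \<open>pressure solves and momentum update\<close>
    and H_def: "H = with_wall_state G enthalpy_flux Nent went (\<lambda>c. (h c, mss c))"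
    and pressure1: "solves_pressure_system G dt rhoe p\<epsilon> M \<rho>1 h kap
                      (pressure_rhs G dt Ess Bt \<rho>1 mss H) pt"
    and step_m1: "\<And>c. c \<in> cells G \<Longrightarrow> m1 c = mss c - dt *\<^sub>R grad pt c"
    and pressure2: "solves_pressure_system G dt rhoe p\<epsilon> M \<rho>1 h kap
                      (pressure_rhs G dt Ess Bt \<rho>1 m1 H) p1"
    \<comment> \<open>total energy at the new time level\<close>
    and E1: "\<And>c. c \<in> cells G \<Longrightarrow>
        E1 c = V_mod (rhoe (\<rho>1 c)) p\<epsilon> M (p1 c) + (norm (m1 c))\<^sup>2 / (2 * \<rho>1 c)
               + (norm (Bt c))\<^sup>2 / 2"
  shows "(\<Sum>c\<in>cells G. E1 c * dx G * dy G) = (\<Sum>c\<in>cells G. E0 c * dx G * dy G)"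
proof -
  \<comment> \<open>The second solve is the relevant one: its right-hand side contains the updated
    momentum \<open>m1\<close>, as does \<open>E1\<close>.\<close>
  have "(\<Sum>c\<in>cells G. E1 c) = (\<Sum>c\<in>cells G. Ess c)"
    using sum_pressure_solution[OF pressure2] E1 wall_ent
    by (simp add: H_def enthalpy_flux_wall)
  also have "\<dots> = (\<Sum>c\<in>cells G. Es c)"
    by (rule sum_explicit_update[OF step_Ess]) (simp_all add: mag_energy_flux_wall wall_mag)
  also have "\<dots> = (\<Sum>c\<in>cells G. E0 c)"
    by (rule sum_explicit_update[OF step_Es]) (simp_all add: adv_energy_flux_wall wall_adv)
  finally show ?thesis
    by (simp flip: sum_distrib_right)
qed

end
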